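(* There exists a universal constant $c>0$ such that for every integer $k\ge 1$, with $n = 2^k$, the $2^k\times 2^k$ discrete Haar basis matrix $A_k$ satisfies $$\mathrm{hervecdisc}(A_k) \ge c\,\sqrt{\log n}\cdot \mathrm{detlb}(A_k).$$
   Context: The discrete Haar basis matrices $A_k\in\{-1,0,1\}^{2^k\times 2^k}$ are defined recursively by $A_0=[1]$ and $$A_k=\begin{bmatrix}A_{k-1} & I_{2^{k-1}}\\ A_{k-1} & -I_{2^{k-1}}\end{bmatrix},\quad k\ge1,$$ where $I_{2^{k-1}}$ is the $2^{k-1}\times 2^{k-1}$ identity matrix. For a real $m\times n$ matrix $A$, the vector discrepancy is $$\mathrm{vecdisc}(A)=\min_{v_1,\dots,v_n\in S^{n-1}}\max_{j\in[m]}\Big\|\sum_{i=1}^n A_{j,i}v_i\Big\|_2,$$ where $S^{n-1}$ is the unit sphere of $\mathbb{R}^n$. The hereditary vector discrepancy $\mathrm{hervecdisc}(A)$ is the maximum of $\mathrm{vecdisc}(B)$ over all submatrices $B$ consisting of a nonempty subset of the columns of $A$. The determinant lower bound is $\mathrm{detlb}(A) = \max_{\ell}\max_{B}|\det(B)|^{1/\ell}$, where $\ell$ ranges over $1\le \ell\le \min(m,n)$ and $B$ over all $\ell\times \ell$ submatrices of $A$ (any $\ell$ rows and any $\ell$ columns). *)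

theory Defs
  imports
    "HOL-Analysis.Analysis"
    "Jordan_Normal_Form.Determinant"
    "Jordan_Normal_Form.DL_Submatrix"
begin

fun haar_mat :: "nat \<Rightarrow> real mat" where
  "haar_mat 0 = Matrix.mat 1 1 (\<lambda>_. 1)"
| "haar_mat (Suc k) =
     four_block_mat (haar_mat k) (1\<^sub>m (2 ^ k)) (haar_mat k) (- 1\<^sub>m (2 ^ k))"

definition vec_norm2 :: "real Matrix.vec \<Rightarrow> real" where
  "vec_norm2 v = sqrt (scalar_prod v v)"

definition unit_sphere :: "nat \<Rightarrow> real Matrix.vec set" where
  "unit_sphere n = {v \<in> carrier_vec n. vec_norm2 v = 1}"

definition vec_assignment_disc :: "real mat \<Rightarrow> (nat \<Rightarrow> real Matrix.vec) \<Rightarrow> real" where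
  "vec_assignment_disc A v =
     (MAX j \<in> {..<dim_row A}.
        vec_norm2 (finsum_vec TYPE(real) (dim_col A)
          (\<lambda>i. A $$ (j, i) \<cdot>\<^sub>v v i) {..<dim_col A}))"

text \<open>
  The infimum below is a minimum, see \<open>vecdisc_attained\<close>. Only the values of \<^term>\<open>v\<close> below
  \<^term>\<open>dim_col A\<close> matter.
\<close>

definition vecdisc :: "real mat \<Rightarrow> real" where
  "vecdisc A =
     (INF v \<in> {v. \<forall>i<dim_col A. v i \<in> unit_sphere (dim_col A)}. vec_assignment_disc A v)"

definition hervecdisc :: "real mat \<Rightarrow> real" where
  "hervecdisc A =
     (MAX J \<in> {J. J \<subseteq> {..<dim_col A} \<and> J \<noteq> {}}. vecdisc (submatrix A UNIV J))"

definition detlb :: "real mat \<Rightarrow> real" where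
  "detlb A =
     (MAX l \<in> {1..min (dim_row A) (dim_col A)}.
        MAX (I, J) \<in> {(I, J). I \<subseteq> {..<dim_row A} \<and> J \<subseteq> {..<dim_col A} \<and> card I = l \<and> card J = l}.
          root l \<bar>Determinant.det (submatrix A I J)\<bar>)"

lemma haar_mat_carrier: "haar_mat k \<in> carrier_mat (2 ^ k) (2 ^ k)"
proof (induction k)
  case (Suc k)
  then show ?case
    using four_block_carrier_mat[OF Suc.IH, of "- 1\<^sub>m (2 ^ k)"] by (simp add: mult_2)
qed simp

lemma vec_norm2_L2_set:
  "v \<in> carrier_vec n \<Longrightarrow> vec_norm2 v = L2_set (\<lambda>t. Matrix.vec_index v t) {..<n}"
  by (auto simp: vec_norm2_def L2_set_def scalar_prod_def power2_eq_square lessThan_atLeast0)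

lemma vec_assignment_disc_L2_set:
  assumes "\<And>i. i < dim_col A \<Longrightarrow> v i \<in> carrier_vec (dim_col A)"
  shows "vec_assignment_disc A v =
    (MAX j \<in> {..<dim_row A}.
       L2_set (\<lambda>t. \<Sum>i<dim_col A. A $$ (j, i) * Matrix.vec_index (v i) t) {..<dim_col A})"
proof -
  let ?n = "dim_col A"
  have "vec_norm2 (finsum_vec TYPE(real) ?n (\<lambda>i. A $$ (j, i) \<cdot>\<^sub>v v i) {..<?n}) =
        L2_set (\<lambda>t. \<Sum>i<?n. A $$ (j, i) * Matrix.vec_index (v i) t) {..<?n}" for j
  proof -
    have f: "(\<lambda>i. A $$ (j, i) \<cdot>\<^sub>v v i) \<in> {..<?n} \<rightarrow> carrier_vec ?n"
      using assms by auto
    have d: "dim_vec (v i) = ?n" if "i < ?n" for i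
      using assms[OF that] by auto
    have ix: "Matrix.vec_index (finsum_vec TYPE(real) ?n (\<lambda>i. A $$ (j, i) \<cdot>\<^sub>v v i) {..<?n}) t =
        (\<Sum>i<?n. A $$ (j, i) * Matrix.vec_index (v i) t)" if "t < ?n" for t
      using that assms by (subst index_finsum_vec[OF _ that f])
        (auto intro!: sum.cong simp: d)
    have "vec_norm2 (finsum_vec TYPE(real) ?n (\<lambda>i. A $$ (j, i) \<cdot>\<^sub>v v i) {..<?n}) =
      L2_set (\<lambda>t. Matrix.vec_index
        (finsum_vec TYPE(real) ?n (\<lambda>i. A $$ (j, i) \<cdot>\<^sub>v v i) {..<?n}) t) {..<?n}"
      by (intro vec_norm2_L2_set finsum_vec_closed f)
    also have "\<dots> = L2_set (\<lambda>t. \<Sum>i<?n. A $$ (j, i) * Matrix.vec_index (v i) t) {..<?n}"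
      by (intro L2_set_cong) (auto simp: ix)
    finally show ?thesis .
  qed
  then show ?thesis
    unfolding vec_assignment_disc_def by simp
qed

lemma continuous_on_Max_finite:
  fixes f :: "'j \<Rightarrow> 'a::topological_space \<Rightarrow> real"
  assumes "finite I" "I \<noteq> {}" "\<And>j. j \<in> I \<Longrightarrow> continuous_on S (f j)"
  shows "continuous_on S (\<lambda>x. MAX j \<in> I. f j x)"
  using assms
proof (induction I rule: finite_ne_induct)
  case (insert j I)
  have "(\<lambda>x. MAX j \<in> insert j I. f j x) = (\<lambda>x. max (f j x) (MAX j \<in> I. f j x))"
    using insert.hyps by simp
  moreover have "continuous_on S (f j)" "continuous_on S (\<lambda>x. MAX j \<in> I. f j x)"
    using insert by blast+
  ultimately show ?case
    by (simp only: continuous_on_max)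
qed simp

lemma vecdisc_attained:
  assumes "dim_row A > 0"
  shows "\<exists>v. (\<forall>i<dim_col A. v i \<in> unit_sphere (dim_col A)) \<and> vec_assignment_disc A v = vecdisc A"
proof -
  define n where "n = dim_col A"
  define V where "V = {v. \<forall>i<n. v i \<in> unit_sphere n}"
  define G where "G = (\<lambda>x :: nat \<times> nat \<Rightarrow> real.
    MAX j \<in> {..<dim_row A}. L2_set (\<lambda>t. \<Sum>i<n. A $$ (j, i) * x (i, t)) {..<n})"
  define P where "P = Pi\<^sub>E UNIV
    (\<lambda>p :: nat \<times> nat. if fst p < n \<and> snd p < n then {-1..1::real} else {0})"
  define K where "K = P \<inter> {x. \<forall>i\<in>{..<n}. (\<Sum>t<n. (x (i, t))\<^sup>2) = 1}"
  define vv where "vv = (\<lambda>x :: nat \<times> nat \<Rightarrow> real. \<lambda>i. Matrix.vec n (\<lambda>t. x (i, t)))"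
  define xx where "xx = (\<lambda>v (i, t).
    if i < n \<and> t < n then Matrix.vec_index (v i :: real Matrix.vec) t else 0)"
  have cont: "continuous_on S (\<lambda>x :: nat \<times> nat \<Rightarrow> real. x p)" for p S
    by (intro continuous_on_product_coordinates continuous_on_subset[OF _ subset_UNIV])
  have "compact P"
  proof -
    have "compactin (product_topology (\<lambda>_. euclidean) UNIV) P"
      unfolding P_def compactin_PiE by simp
    then show ?thesis
      by (simp add: euclidean_product_topology)
  qed
  moreover have "closed {x :: nat \<times> nat \<Rightarrow> real. \<forall>i\<in>{..<n}. (\<Sum>t<n. (x (i, t))\<^sup>2) = 1}"
    unfolding Ball_def imp_conv_disj
    by (intro closed_Collect_all closed_Collect_disj closed_Collect_const closed_Collect_eq
        continuous_intros cont)
  ultimately have K: "compact K"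
    unfolding K_def by (rule compact_Int_closed)
  have "continuous_on K G"
    unfolding G_def L2_set_def using assms
    by (intro continuous_on_Max_finite continuous_intros cont) auto
  have sphere: "w \<in> unit_sphere n \<longleftrightarrow>
      w \<in> carrier_vec n \<and> (\<Sum>t<n. (Matrix.vec_index w t)\<^sup>2) = 1" for w
    by (auto simp: unit_sphere_def vec_norm2_L2_set L2_set_def)
  have vv: "vv x \<in> V" "vec_assignment_disc A (vv x) = G x" if "x \<in> K" for x
    using that vec_assignment_disc_L2_set[of A "vv x"]
    by (auto simp: V_def vv_def K_def sphere G_def n_def[symmetric] L2_set_def)
  have xx: "xx v \<in> K" "vec_assignment_disc A v = G (xx v)" if "v \<in> V" for v
  proof -
    have *: "(\<Sum>t<n. (Matrix.vec_index (v i) t)\<^sup>2) = 1" "v i \<in> carrier_vec n" if "i < n" for i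
      using that \<open>v \<in> V\<close> by (auto simp: V_def sphere)
    have "\<bar>Matrix.vec_index (v i) t\<bar> \<le> 1" if "i < n" "t < n" for i t
    proof -
      have "(Matrix.vec_index (v i) t)\<^sup>2 \<le> (\<Sum>t<n. (Matrix.vec_index (v i) t)\<^sup>2)"
        using that by (intro member_le_sum) auto
      then show ?thesis
        using *(1)[OF that(1)] by (simp add: abs_square_le_1)
    qed
    then have "-1 \<le> Matrix.vec_index (v i) t \<and> Matrix.vec_index (v i) t \<le> 1"
      if "i < n" "t < n" for i t
      using that by (simp only: abs_le_iff) (metis minus_le_iff)
    then have "xx v \<in> P"
      by (simp add: P_def xx_def PiE_iff)
    then show "xx v \<in> K"
      using *(1) by (simp add: K_def xx_def)
    show "vec_assignment_disc A v = G (xx v)"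
      using * vec_assignment_disc_L2_set[of A v]
      by (auto simp: G_def n_def[symmetric] xx_def L2_set_def)
  qed
  have "(\<lambda>_. unit_vec n 0) \<in> V"
    by (cases "n = 0") (auto simp: V_def sphere if_distrib[of "\<lambda>z. z\<^sup>2"] cong: if_cong)
  then have "K \<noteq> {}"
    using xx by blast
  then obtain x where x: "x \<in> K" "\<And>y. y \<in> K \<Longrightarrow> G x \<le> G y"
    using continuous_attains_inf[OF K _ \<open>continuous_on K G\<close>] by blast
  have "Inf (vec_assignment_disc A ` V) = vec_assignment_disc A (vv x)"
  proof (intro cInf_eq_minimum)
    show "vec_assignment_disc A (vv x) \<in> vec_assignment_disc A ` V"
      using vv(1)[OF x(1)] by (rule imageI)
    show "vec_assignment_disc A (vv x) \<le> d" if "d \<in> vec_assignment_disc A ` V" for d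
      using that vv(2)[OF x(1)] x(2) xx by auto
  qed
  then show ?thesis
    using vv[OF x(1)] by (auto simp: vecdisc_def V_def n_def)
qed

end

theory Submission
  imports Defs
begin

text \<open>
  Upper bound on minors: in the column of largest index, two rows with the same nonzero entry agree
  in all other columns. So if a minor is nonzero, its last column has at most one entry \<open>1\<close> and
  one entry \<open>-1\<close>, and Laplace expansion along it gives \<open>\<bar>det\<bar> \<le> 2 ^ l\<close> by induction, whence
  \<open>detlb \<le> 2\<close>. Lower bound on the discrepancy: the columns are orthogonal, so the squared
  row norms of any assignment of unit vectors sum to the squared Frobenius norm \<open>2 ^ k * (k + 1)\<close>,
  and some row has norm at least \<open>sqrt (k + 1)\<close>.
\<close>

section \<open>Block structure and entries of the Haar matrices\<close>

lemma dim_haar_mat [simp]: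
  "dim_row (haar_mat k) = 2 ^ k" "dim_col (haar_mat k) = 2 ^ k"
  using haar_mat_carrier[of k] by auto

lemma haar_mat_Suc_index:
  assumes "r < 2 ^ k" "i < 2 ^ k"
  shows "haar_mat (Suc k) $$ (r, i) = haar_mat k $$ (r, i)"
    and "haar_mat (Suc k) $$ (2 ^ k + r, i) = haar_mat k $$ (r, i)"
    and "haar_mat (Suc k) $$ (r, 2 ^ k + i) = (if r = i then 1 else 0)"
    and "haar_mat (Suc k) $$ (2 ^ k + r, 2 ^ k + i) = (if r = i then -1 else 0)"
  using assms by auto

lemma less_power2_Suc_cases:
  fixes r k :: nat
  assumes "r < 2 ^ Suc k"
  obtains (low) "r < 2 ^ k" | (high) s where "r = 2 ^ k + s" "s < 2 ^ k"
proof (cases "r < 2 ^ k")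
  case False
  then show ?thesis
    using assms by (intro high[of "r - 2 ^ k"]) auto
qed (rule low)

lemma haar_mat_entries:
  assumes "r < 2 ^ k" "i < 2 ^ k"
  shows "haar_mat k $$ (r, i) \<in> {-1, 0, 1}"
  using assms
proof (induction k arbitrary: r i)
  case (Suc k)
  show ?case
  proof (cases "i < 2 ^ k")
    case True
    then show ?thesis
      using Suc.prems(1) Suc.IH[of _ i]
      by (elim less_power2_Suc_cases) (simp_all only: haar_mat_Suc_index)
  next
    case False
    then obtain j where "i = 2 ^ k + j" "j < 2 ^ k"
      using Suc.prems(2) by (elim less_power2_Suc_cases) auto
    then show ?thesis
      using Suc.prems(1)
      by (elim less_power2_Suc_cases) (simp_all only: haar_mat_Suc_index, simp_all)
  qed
qed simp

text \<open>Induction on \<open>k\<close>. The left half of the columns is the smaller matrix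
  stacked twice, so there the claim is inherited; a column of the right half has a single 1 and a
  single -1, which forces \<open>r = r'\<close>.\<close>

lemma haar_mat_rows_agree:
  assumes "r < 2 ^ k" "r' < 2 ^ k" "i \<le> j" "j < 2 ^ k"
    and "haar_mat k $$ (r, j) = haar_mat k $$ (r', j)" "haar_mat k $$ (r, j) \<noteq> 0"
  shows "haar_mat k $$ (r, i) = haar_mat k $$ (r', i)"
  using assms
proof (induction k arbitrary: r r' i j)
  case (Suc k)
  show ?case
  proof (cases "j < 2 ^ k")
    case True
    \<comment> \<open>\<open>m\<close> folds the lower half of the rows onto the upper half; on the
      left columns this preserves all entries.\<close>
    define m where "m = (\<lambda>r :: nat. if r < 2 ^ k then r else r - 2 ^ k)"
    have m: "m r < 2 ^ k \<and> (\<forall>i < 2 ^ k. haar_mat (Suc k) $$ (r, i) = haar_mat k $$ (m r, i))"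
      if "r < 2 ^ Suc k" for r
      using that by (auto simp: m_def)
    show ?thesis
      using Suc.IH[of "m r" "m r'" i j] Suc.prems m[of r] m[of r'] True by simp
  next
    case False
    \<comment> \<open>The sign of the entry tells the upper from the lower half, and its place on
      the block diagonal then fixes the row.\<close>
    then have "r = r'"
      using Suc.prems
      by (auto simp: not_less split: if_splits)
    then show ?thesis by simp
  qed
qed simp

section \<open>Minors and the determinant lower bound\<close>

text \<open>The array \<open>F\<close> and the sets \<open>R\<close>, \<open>C\<close> stay fixed
  while the selecting maps \<open>r\<close> and \<open>c\<close> vary: deleting a row and a column
  only changes these maps, so the induction hypothesis covers every minor of the Laplace
  expansion.\<close>

lemma abs_det_le_power2:
  fixes F :: "'r \<Rightarrow> nat \<Rightarrow> real"
  assumes entries: "\<And>x y. x \<in> R \<Longrightarrow> y \<in> C \<Longrightarrow> F x y \<in> {-1, 0, 1}"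
    and agree: "\<And>x x' y z. x \<in> R \<Longrightarrow> x' \<in> R \<Longrightarrow> y \<in> C \<Longrightarrow> z \<in> C \<Longrightarrow> y \<le> z \<Longrightarrow>
      F x z = F x' z \<Longrightarrow> F x z \<noteq> 0 \<Longrightarrow> F x y = F x' y"
    and "\<And>i. i < n \<Longrightarrow> r i \<in> R" "\<And>i. i < n \<Longrightarrow> c i \<in> C"
  shows "\<bar>Determinant.det (Matrix.mat n n (\<lambda>(i, j). F (r i) (c j)))\<bar> \<le> 2 ^ n"
  using assms(3,4)
proof (induction n arbitrary: r c)
  case 0
  show ?case by (simp add: Determinant.det_def)
next
  case (Suc n)
  define M where "M = Matrix.mat (Suc n) (Suc n) (\<lambda>(i, j). F (r i) (c j))"
  have M: "M \<in> carrier_mat (Suc n) (Suc n)"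
    by (simp add: M_def)
  \<comment> \<open>As \<open>c\<close> is arbitrary, the column of largest original index may stand
    at any position \<open>j\<close>. From this column \<open>agree\<close> reaches all the
    others.\<close>
  have "Max (c ` {..n}) \<in> c ` {..n}"
    by (intro Max_in) auto
  then obtain j where "Max (c ` {..n}) = c j" "j \<in> {..n}"
    by (rule imageE)
  then have j: "j \<le> n" by simp
  have cj: "c j' \<le> c j" if "j' \<le> n" for j'
    unfolding \<open>Max (c ` {..n}) = c j\<close>[symmetric] using that by simp
  have r: "r i \<in> R" and c: "c i \<in> C" if "i \<le> n" for i
    using that Suc.prems by auto
  show ?case
  proof (cases "inj_on (\<lambda>i. F (r i) (c j)) {i. i \<le> n \<and> F (r i) (c j) \<noteq> 0}")
    case False
    then obtain i i' where i: "i \<le> n" "i' \<le> n" "i \<noteq> i'"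
        "F (r i) (c j) = F (r i') (c j)" "F (r i) (c j) \<noteq> 0"
      unfolding inj_on_def by auto
    have "F (r i) (c j') = F (r i') (c j')" if "j' \<le> n" for j'
      by (rule agree[OF r r c c cj]) (use i j that in auto)
    then have "Matrix.row M i = Matrix.row M i'"
      using i by (intro eq_vecI) (simp_all add: M_def)
    then have "Determinant.det M = 0"
      using i by (intro Determinant.det_identical_rows[OF M, of i i']) auto
    then show ?thesis by (simp add: M_def)
  next
    case True
    define S where "S = {i. i \<le> n \<and> F (r i) (c j) \<noteq> 0}"
    \<comment> \<open>The nonzero entries of column \<open>j\<close> are distinct elements of
      \<open>{-1, 1}\<close>, so at most two terms survive; this is the factor 2 gained in each
      step.\<close>
    have "(\<lambda>i. F (r i) (c j)) ` S \<subseteq> {-1, 1}"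
      using entries[OF r c[OF j]] by (auto simp: S_def)
    then have "card S \<le> card {-1, 1 :: real}"
      using True unfolding S_def[symmetric] by (intro card_inj_on_le) auto
    then have S: "card S \<le> 2" by simp
    have minor: "\<bar>Determinant.det (mat_delete M i j)\<bar> \<le> 2 ^ n" if "i \<le> n" for i
    proof -
      have "mat_delete M i j = Matrix.mat n n (\<lambda>(i', j').
          F ((\<lambda>i'. r (if i' < i then i' else Suc i')) i')
            ((\<lambda>j'. c (if j' < j then j' else Suc j')) j'))"
        by (auto simp: mat_delete_def M_def)
      then show ?thesis
        using Suc.IH[of "\<lambda>i'. r (if i' < i then i' else Suc i')"
            "\<lambda>j'. c (if j' < j then j' else Suc j')"] Suc.prems by simp
    qed
    have "\<bar>Determinant.det M\<bar> = \<bar>\<Sum>i<Suc n. M $$ (i, j) * cofactor M i j\<bar>"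
      using j by (subst laplace_expansion_column[OF M, of j]) auto
    also have "\<dots> = \<bar>\<Sum>i\<in>S. M $$ (i, j) * cofactor M i j\<bar>"
      using j by (intro arg_cong[of _ _ abs] sum.mono_neutral_right) (auto simp: S_def M_def)
    also have "\<dots> \<le> (\<Sum>i\<in>S. \<bar>M $$ (i, j) * cofactor M i j\<bar>)"
      by (rule sum_abs)
    also have "\<dots> \<le> (\<Sum>i\<in>S. 2 ^ n)"
    proof (rule sum_mono)
      fix i assume "i \<in> S"
      then have i: "i \<le> n" by (simp add: S_def)
      have "F (r i) (c j) \<in> {-1, 0, 1}"
        by (intro entries r c i j)
      then have "\<bar>M $$ (i, j)\<bar> \<le> 1"
        using i j by (auto simp: M_def)
      moreover have "\<bar>cofactor M i j\<bar> \<le> 2 ^ n"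
        using minor[OF i] by (simp add: cofactor_def abs_mult power_abs)
      ultimately show "\<bar>M $$ (i, j) * cofactor M i j\<bar> \<le> 2 ^ n"
        using mult_mono[of "\<bar>M $$ (i, j)\<bar>" 1 "\<bar>cofactor M i j\<bar>" "2 ^ n"] by (simp add: abs_mult)
    qed
    also have "\<dots> \<le> 2 ^ Suc n"
      using S by simp
    finally show ?thesis by (simp add: M_def)
  qed
qed

lemma abs_det_submatrix_haar_mat_le:
  assumes "I \<subseteq> {..<2 ^ k}" "J \<subseteq> {..<2 ^ k}" "card I = l" "card J = l"
  shows "\<bar>Determinant.det (submatrix (haar_mat k) I J)\<bar> \<le> 2 ^ l"
proof -
  \<comment> \<open>\<open>submatrix\<close> counts only indices within the dimensions of the
    matrix; here these are all of \<open>I\<close> and \<open>J\<close>, so the size is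
    \<open>l\<close>.\<close>
  have "{i. i < 2 ^ k \<and> i \<in> I} = I" "{j. j < 2 ^ k \<and> j \<in> J} = J"
    using assms(1,2) by auto
  then have "submatrix (haar_mat k) I J =
      Matrix.mat l l (\<lambda>(i, j). haar_mat k $$ (pick I i, pick J j))"
    by (simp add: submatrix_def assms(3,4))
  moreover have "\<bar>Determinant.det (Matrix.mat l l
      (\<lambda>(i, j). haar_mat k $$ (pick I i, pick J j)))\<bar> \<le> 2 ^ l"
  proof (rule abs_det_le_power2[where R = "{..<2 ^ k}" and C = "{..<2 ^ k}"
        and F = "\<lambda>x y. haar_mat k $$ (x, y)"])
    show "pick I i \<in> {..<2 ^ k}" if "i < l" for i
      using pick_in_set_le[of i I] that assms(1,3) by (simp add: subset_iff)
    show "pick J i \<in> {..<2 ^ k}" if "i < l" for i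
      using pick_in_set_le[of i J] that assms(2,4) by (simp add: subset_iff)
    show "haar_mat k $$ (x, y) \<in> {-1, 0, 1}" if "x \<in> {..<2 ^ k}" "y \<in> {..<2 ^ k}" for x y
      using that by (intro haar_mat_entries) simp_all
    show "haar_mat k $$ (x, y) = haar_mat k $$ (x', y)"
      if "x \<in> {..<2 ^ k}" "x' \<in> {..<2 ^ k}" "z \<in> {..<2 ^ k}" "y \<le> z"
        "haar_mat k $$ (x, z) = haar_mat k $$ (x', z)" "haar_mat k $$ (x, z) \<noteq> 0" for x x' y z
      using haar_mat_rows_agree[OF _ _ that(4) _ that(5,6)] that(1-3) by simp
  qed
  ultimately show ?thesis by simp
qed

lemma detlb_haar_mat_le: "detlb (haar_mat k) \<le> 2"
proof -
  define Q where "Q = (\<lambda>l. {(I, J). I \<subseteq> {..<2 ^ k :: nat} \<and> J \<subseteq> {..<2 ^ k :: nat} \<and>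
    card I = l \<and> card J = l})"
  have "(MAX (I, J) \<in> Q l. root l \<bar>Determinant.det (submatrix (haar_mat k) I J)\<bar>) \<le> 2"
    if l: "l \<in> {1..2 ^ k}" for l
  proof (rule Max.boundedI)
    have "Q l \<subseteq> Pow {..<2 ^ k} \<times> Pow {..<2 ^ k}"
      by (auto simp: Q_def)
    then show "finite ((\<lambda>(I, J). root l \<bar>Determinant.det (submatrix (haar_mat k) I J)\<bar>) ` Q l)"
      by (intro finite_imageI) (auto intro: finite_subset)
    \<comment> \<open>The leading block shows that the inner maximum ranges over a nonempty
      set.\<close>
    have "({..<l}, {..<l}) \<in> Q l"
      using l by (auto simp: Q_def)
    then show "(\<lambda>(I, J). root l \<bar>Determinant.det (submatrix (haar_mat k) I J)\<bar>) ` Q l \<noteq> {}"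
      by blast
  next
    fix d assume "d \<in> (\<lambda>(I, J). root l \<bar>Determinant.det (submatrix (haar_mat k) I J)\<bar>) ` Q l"
    then obtain I J where IJ: "(I, J) \<in> Q l"
      and d: "d = root l \<bar>Determinant.det (submatrix (haar_mat k) I J)\<bar>"
      by auto
    have "d \<le> root l (2 ^ l)"
      unfolding d using l IJ by (intro real_root_le_mono abs_det_submatrix_haar_mat_le) (auto simp: Q_def)
    then show "d \<le> 2"
      using l by (simp add: real_root_power_cancel)
  qed
  then show ?thesis
    unfolding detlb_def by (intro Max.boundedI) (auto simp: Q_def)
qed

section \<open>Row norms and vector discrepancy\<close>

lemma sum_lessThan_power2_Suc:
  fixes f :: "nat \<Rightarrow> 'a::comm_monoid_add"
  shows "(\<Sum>r<2 ^ Suc k. f r) = (\<Sum>r<2 ^ k. f r) + (\<Sum>r<2 ^ k. f (2 ^ k + r))"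
proof -
  have "(\<Sum>r<2 ^ Suc k. f r) = (\<Sum>r<2 ^ k. f r) + (\<Sum>r = 2 ^ k..<2 ^ Suc k. f r)"
    by (simp add: lessThan_atLeast0 sum.atLeastLessThan_concat)
  also have "(\<Sum>r = 2 ^ k..<2 ^ Suc k. f r) = (\<Sum>r<2 ^ k. f (2 ^ k + r))"
    using sum.shift_bounds_nat_ivl[of f 0 "2 ^ k" "2 ^ k"]
    by (simp add: lessThan_atLeast0 add.commute mult_2)
  finally show ?thesis .
qed

text \<open>The orthogonality of the columns enters through a recursion: by the parallelogram law
  the total doubles and gains \<open>2 * 2 ^ k\<close> in passing from \<open>k\<close> to
  \<open>Suc k\<close>. The coordinate set \<open>T\<close> is independent of \<open>k\<close>,
  since the induction halves the number of vectors but keeps their dimension.\<close>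

lemma haar_mat_sum_squares:
  fixes f :: "nat \<Rightarrow> 't \<Rightarrow> real"
  assumes "\<And>i. i < 2 ^ k \<Longrightarrow> (\<Sum>t\<in>T. (f i t)\<^sup>2) = 1"
  shows "(\<Sum>r<2 ^ k. \<Sum>t\<in>T. (\<Sum>i<2 ^ k. haar_mat k $$ (r, i) * f i t)\<^sup>2) = 2 ^ k * (real k + 1)"
  using assms
proof (induction k arbitrary: f)
  case 0
  then show ?case by simp
next
  case (Suc k)
  define y where "y = (\<lambda>r t. \<Sum>i<2 ^ k. haar_mat k $$ (r, i) * f i t)"
  define z where "z = (\<lambda>r. f (2 ^ k + r))"
  \<comment> \<open>The left block contributes \<open>y\<close>; the identity block selects the
    single vector \<open>z r\<close>, with plus sign in the upper half and minus sign in the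
    lower.\<close>
  have low: "(\<Sum>i<2 ^ Suc k. haar_mat (Suc k) $$ (r, i) * f i t) = y r t + z r t"
    if "r < 2 ^ k" for r t
    unfolding sum_lessThan_power2_Suc using that
    by (simp del: haar_mat.simps add: haar_mat_Suc_index y_def z_def if_distrib[of "\<lambda>a. a * _"] cong: if_cong)
  have high: "(\<Sum>i<2 ^ Suc k. haar_mat (Suc k) $$ (2 ^ k + r, i) * f i t) = y r t - z r t"
    if "r < 2 ^ k" for r t
    unfolding sum_lessThan_power2_Suc using that
    by (simp del: haar_mat.simps add: haar_mat_Suc_index y_def z_def if_distrib[of "\<lambda>a. a * _"] cong: if_cong)
  have "(\<Sum>r<2 ^ Suc k. \<Sum>t\<in>T. (\<Sum>i<2 ^ Suc k. haar_mat (Suc k) $$ (r, i) * f i t)\<^sup>2) =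
      (\<Sum>r<2 ^ k. \<Sum>t\<in>T. (y r t + z r t)\<^sup>2) + (\<Sum>r<2 ^ k. \<Sum>t\<in>T. (y r t - z r t)\<^sup>2)"
    by (subst sum_lessThan_power2_Suc) (simp del: haar_mat.simps power_Suc add: low high)
  also have "\<dots> = (\<Sum>r<2 ^ k. \<Sum>t\<in>T. (y r t + z r t)\<^sup>2 + (y r t - z r t)\<^sup>2)"
    by (simp add: sum.distrib)
  \<comment> \<open>Parallelogram law: the cross terms of rows \<open>r\<close> and
    \<open>2 ^ k + r\<close> cancel.\<close>
  also have "\<dots> = (\<Sum>r<2 ^ k. \<Sum>t\<in>T. 2 * (y r t)\<^sup>2 + 2 * (z r t)\<^sup>2)"
    by (intro sum.cong refl) (simp add: power2_eq_square algebra_simps)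
  also have "\<dots> = 2 * (\<Sum>r<2 ^ k. \<Sum>t\<in>T. (y r t)\<^sup>2) + 2 * (\<Sum>r<2 ^ k. \<Sum>t\<in>T. (z r t)\<^sup>2)"
    by (simp add: sum.distrib sum_distrib_left)
  also have "(\<Sum>r<2 ^ k. \<Sum>t\<in>T. (y r t)\<^sup>2) = 2 ^ k * (real k + 1)"
    unfolding y_def by (rule Suc.IH) (simp add: Suc.prems)
  also have "(\<Sum>r<2 ^ k. \<Sum>t\<in>T. (z r t)\<^sup>2) = 2 ^ k"
    by (simp add: z_def Suc.prems)
  finally show ?case by (simp add: algebra_simps)
qed

lemma vecdisc_haar_mat_ge: "sqrt (real k + 1) \<le> vecdisc (haar_mat k)"
proof -
  \<comment> \<open>An optimal assignment turns the infimum into the largest row norm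
    \<open>D\<close> of one concrete \<open>v\<close>.\<close>
  obtain v where v: "\<And>i. i < 2 ^ k \<Longrightarrow> v i \<in> unit_sphere (2 ^ k)"
    and eq: "vec_assignment_disc (haar_mat k) v = vecdisc (haar_mat k)"
    using vecdisc_attained[of "haar_mat k"] by auto
  define L where "L = (\<lambda>j. L2_set (\<lambda>t. \<Sum>i<2 ^ k. haar_mat k $$ (j, i) * Matrix.vec_index (v i) t)
    {..<2 ^ k})"
  define D where "D = (MAX j \<in> {..<2 ^ k}. L j)"
  have carrier: "v i \<in> carrier_vec (2 ^ k)" if "i < 2 ^ k" for i
    using v[OF that] by (simp add: unit_sphere_def)
  then have D: "vecdisc (haar_mat k) = D"
    using vec_assignment_disc_L2_set[of "haar_mat k" v] eq by (simp add: D_def L_def)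
  have LD: "0 \<le> L j \<and> L j \<le> D" if "j < 2 ^ k" for j
    using that by (auto simp: D_def L_def L2_set_nonneg)
  have unit: "(\<Sum>t<2 ^ k. (Matrix.vec_index (v i) t)\<^sup>2) = 1" if "i < 2 ^ k" for i
    using v[OF that] vec_norm2_L2_set[OF carrier[OF that]] by (simp add: unit_sphere_def L2_set_def)
  have "2 ^ k * (real k + 1) = (\<Sum>j<2 ^ k. (L j)\<^sup>2)"
    by (simp add: L_def L2_set_def sum_nonneg haar_mat_sum_squares[OF unit])
  \<comment> \<open>Averaging over the \<open>2 ^ k\<close> rows: the mean of the squared norms is
    at most the square of the largest norm.\<close>
  also have "\<dots> \<le> (\<Sum>j<2 ^ k :: nat. D\<^sup>2)"
    using LD by (intro sum_mono power_mono) auto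
  finally have "real k + 1 \<le> D\<^sup>2"
    by simp
  moreover have "0 \<le> D"
    using LD[of 0] by simp
  ultimately show ?thesis
    using D by (simp add: real_le_lsqrt)
qed

section \<open>Hereditary discrepancy and conclusion\<close>

lemma submatrix_UNIV_lessThan: "submatrix A UNIV {..<dim_col A} = A"
proof -
  have "pick {..<dim_col A} j = j" if "j < dim_col A" for j
    using pick_reduce_set[of j "dim_col A" UNIV] that
    by (simp add: pick_UNIV lessThan_def)
  then show ?thesis
    by (intro eq_matI) (auto simp: submatrix_def pick_UNIV)
qed

text \<open>The set of all columns is one of the choices of \<open>J\<close>, nonempty by the
  hypothesis; for the Haar matrices this choice already gives the desired lower bound.\<close>

lemma vecdisc_le_hervecdisc:
  assumes "dim_col A > 0"
  shows "vecdisc A \<le> hervecdisc A"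
  unfolding hervecdisc_def
proof (rule Max_ge)
  show "vecdisc A \<in> (\<lambda>J. vecdisc (submatrix A UNIV J)) ` {J. J \<subseteq> {..<dim_col A} \<and> J \<noteq> {}}"
    using assms by (intro image_eqI[of _ _ "{..<dim_col A}"]) (auto simp: submatrix_UNIV_lessThan)
qed simp

theorem theorem3:
  shows "\<exists>c::real. c > 0 \<and>
    (\<forall>k n :: nat. k \<ge> 1 \<longrightarrow> n = 2 ^ k \<longrightarrow>
      hervecdisc (haar_mat k) \<ge> c * sqrt (ln (real n)) * detlb (haar_mat k))"
proof (intro exI[of _ "1 / 2"] conjI allI impI)
  \<comment> \<open>The constant \<open>1 / 2\<close> cancels the bound 2 on \<open>detlb\<close>.
    What remains is to compare \<open>ln n = k * ln 2\<close> with \<open>k + 1\<close>, for which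
    \<open>ln 2 \<le> 1\<close> suffices.\<close>
  fix k n :: nat
  assume "k \<ge> 1" and n: "n = 2 ^ k"
  have "ln 2 \<le> (1 :: real)"
    using ln_le_minus_one[of 2] by simp
  then have "ln (real n) \<le> real k + 1"
    using mult_left_mono[of "ln 2" 1 "real k"] by (simp add: n ln_realpow)
  have "1 / 2 * sqrt (ln (real n)) * detlb (haar_mat k) \<le> 1 / 2 * sqrt (ln (real n)) * 2"
    by (intro mult_left_mono detlb_haar_mat_le) (simp add: n)
  also have "\<dots> \<le> sqrt (real k + 1)"
    using \<open>ln (real n) \<le> real k + 1\<close> by simp
  also have "\<dots> \<le> vecdisc (haar_mat k)"
    by (rule vecdisc_haar_mat_ge)
  also have "\<dots> \<le> hervecdisc (haar_mat k)"
    by (rule vecdisc_le_hervecdisc) simp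
  finally show "1 / 2 * sqrt (ln (real n)) * detlb (haar_mat k) \<le> hervecdisc (haar_mat k)" .
qed simp

end
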